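(* Let $d\in\mathbb N$, $a\in\mathbb N_0$, $n\in\mathbb N_0$, and let $PrEu(d,a;n,x):=\sum_{k=0}^n rEu(d,a;n,k)\,x^k$. Then, as formal power series in $x$, $$\sum_{m=0}^{\infty}\Big(\sum_{j=0}^m(a+d\,j)^n\Big)x^m=\frac{1}{(1-x)^{n+2}}\,PrEu(d,a;n,x).$$
   Context: $\mathbb N=\{1,2,\dots\}$, $\mathbb N_0=\{0,1,2,\dots\}$, $0^0:=1$. The generalized Stirling numbers of the second kind $S2(d,a;n,m)$, $0\le m\le n$, are defined by the operator identity $(a\,\mathbf 1+d\,\mathbf E_x)^n=\sum_{m=0}^n S2(d,a;n,m)\,x^m\,\mathbf d_x^{\,m}$, where $\mathbf d_x$ is differentiation with respect to $x$, $\mathbf E_x:=x\,\mathbf d_x$ and $\mathbf 1$ is the identity operator. The generalized (row reversed) Eulerian numbers are defined, for $0\le k\le n$, by $rEu(d,a;n,k):=\sum_{j=0}^k(-1)^{k-j}\binom{n-j}{k-j}S2(d,a;n,j)\,j!$. *)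

theory Defs
  imports
    "HOL-Computational_Algebra.Formal_Power_Series"
    "HOL-Computational_Algebra.Polynomial_FPS"
begin

definition euler_op :: "rat fps \<Rightarrow> rat fps" where
  "euler_op f = fps_X * fps_deriv f"

definition aff_op :: "nat \<Rightarrow> nat \<Rightarrow> rat fps \<Rightarrow> rat fps" where
  "aff_op d a f = fps_const (of_nat a) * f + fps_const (of_nat d) * euler_op f"

text \<open>
  The operator identity is read as an identity of linear operators on rational formal power
  series in \<open>x\<close>; the power on the left is iterated composition. The clause for \<open>m > n\<close> only
  fixes the values outside the range \<open>0 \<le> m \<le> n\<close>, so that the coefficient function is determined.
\<close>

definition is_S2 :: "nat \<Rightarrow> nat \<Rightarrow> nat \<Rightarrow> (nat \<Rightarrow> rat) \<Rightarrow> bool" where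
  "is_S2 d a n s \<longleftrightarrow>
     (\<forall>f. (aff_op d a ^^ n) f =
          (\<Sum>m=0..n. fps_const (s m) * fps_X ^ m * (fps_deriv ^^ m) f)) \<and>
     (\<forall>m>n. s m = 0)"

definition S2 :: "nat \<Rightarrow> nat \<Rightarrow> nat \<Rightarrow> nat \<Rightarrow> rat" where
  "S2 d a n = (THE s. is_S2 d a n s)"

definition rEu :: "nat \<Rightarrow> nat \<Rightarrow> nat \<Rightarrow> nat \<Rightarrow> rat" where
  "rEu d a n k =
     (\<Sum>j=0..k. (-1) ^ (k - j) * of_nat ((n - j) choose (k - j)) * S2 d a n j * fact j)"

definition PrEu :: "nat \<Rightarrow> nat \<Rightarrow> nat \<Rightarrow> rat poly" where
  "PrEu d a n = (\<Sum>k=0..n. monom (rEu d a n k) k)"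


text \<open>The coefficients in the operator identity exist and are unique, so \<open>S2\<close> is well defined.\<close>

lemma euler_op_term:
  fixes f :: "rat fps"
  shows "euler_op (fps_const c * fps_X ^ m * (fps_deriv ^^ m) f) =
    fps_const (of_nat m * c) * fps_X ^ m * (fps_deriv ^^ m) f +
    fps_const c * fps_X ^ Suc m * (fps_deriv ^^ Suc m) f"
proof (cases m)
  case 0
  then show ?thesis by (simp add: euler_op_def algebra_simps)
next
  case (Suc k)
  have "fps_deriv (fps_X ^ m :: rat fps) = of_nat m * fps_X ^ k"
    using fps_deriv_power'[of "fps_X :: rat fps" m] Suc by simp
  then have X: "fps_X * fps_deriv (fps_X ^ m) = of_nat m * (fps_X ^ m :: rat fps)"
    using Suc by (simp only: power_Suc mult.left_commute)
  have c: "fps_const (of_nat m * c) = of_nat m * fps_const c"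
    by (simp only: fps_const_mult[symmetric] fps_of_nat)
  have eu: "euler_op (fps_const c * p * q) =
      fps_const c * (fps_X * fps_deriv p) * q + fps_const c * (fps_X * p) * fps_deriv q" for p q
    by (simp add: euler_op_def algebra_simps)
  show ?thesis
    unfolding eu X c funpow.simps o_apply power_Suc by (simp only: mult.assoc mult.left_commute)
qed

lemma euler_op_sum: "euler_op (sum g A) = (\<Sum>i\<in>A. euler_op (g i))"
  by (simp add: euler_op_def fps_deriv_sum sum_distrib_left)

lemma is_S2_exists: "\<exists>s. is_S2 d a n s"
proof (induction n)
  case 0
  show ?case
    by (rule exI[of _ "\<lambda>m. if m = 0 then 1 else 0"]) (simp add: is_S2_def)
next
  case (Suc n)
  then obtain s where s: "is_S2 d a n s" by blast
  define t where "t m = of_nat (a + d * m) * s m + of_nat d * (if m = 0 then 0 else s (m - 1))" for m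
  define T where "T c m f = fps_const c * fps_X ^ m * (fps_deriv ^^ m) f" for c m and f :: "rat fps"
  have T_add: "T (b + c) m f = T b m f + T c m f" for b c m f
    by (simp only: T_def fps_const_add[symmetric] distrib_right)
  have T_const: "fps_const b * T c m f = T (b * c) m f" for b c m f
    by (simp only: T_def fps_const_mult[symmetric] mult.assoc)
  have T_0: "T 0 m f = 0" for m f
    by (simp add: T_def)
  have eu: "euler_op (T c m f) = T (of_nat m * c) m f + T c (Suc m) f" for c m f
    unfolding T_def by (rule euler_op_term)
  have "(aff_op d a ^^ Suc n) f = (\<Sum>m=0..Suc n. T (t m) m f)" for f
  proof -
    have "(aff_op d a ^^ Suc n) f = aff_op d a (\<Sum>m=0..n. T (s m) m f)"
      using s by (simp add: is_S2_def T_def)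
    also have "\<dots> = (\<Sum>m=0..n. T (of_nat a * s m) m f + T (of_nat d * (of_nat m * s m)) m f
        + T (of_nat d * s m) (Suc m) f)"
      by (simp add: aff_op_def euler_op_sum eu sum_distrib_left distrib_left T_const
          sum.distrib add.assoc)
    also have "\<dots> = (\<Sum>m=0..n. T (of_nat (a + d * m) * s m) m f)
        + (\<Sum>m=0..n. T (of_nat d * s m) (Suc m) f)"
      by (simp add: sum.distrib ring_distribs T_add mult.assoc)
    also have "(\<Sum>m=0..n. T (of_nat (a + d * m) * s m) m f) =
        (\<Sum>m=0..Suc n. T (of_nat (a + d * m) * s m) m f)"
      using s by (simp add: is_S2_def T_0)
    also have "(\<Sum>m=0..n. T (of_nat d * s m) (Suc m) f) =
        (\<Sum>m=0..Suc n. T (of_nat d * (if m = 0 then 0 else s (m - 1))) m f)"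
      by (subst sum.atLeast0_atMost_Suc_shift) (simp add: T_0)
    finally show ?thesis
      by (simp only: t_def T_add sum.distrib)
  qed
  moreover have "\<forall>m>Suc n. t m = 0"
    using s by (simp add: is_S2_def t_def)
  ultimately have "is_S2 d a (Suc n) t"
    by (simp add: is_S2_def T_def)
  then show ?case by blast
qed

lemma fps_deriv_funpow_X_power:
  "fps_nth ((fps_deriv ^^ m) (fps_X ^ m :: rat fps)) 0 = fact m"
  by (simp add: fps_0th_higher_deriv)

lemma is_S2_unique:
  assumes "is_S2 d a n s" "is_S2 d a n t"
  shows "s = t"
proof
  fix k
  show "s k = t k"
  proof (induction k rule: less_induct)
    case (less k)
    show ?case
    proof (cases "k \<le> n")
      case True
      define T where "T c m = fps_nth (fps_const c * fps_X ^ m * (fps_deriv ^^ m) (fps_X ^ k)) k"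
        for c :: rat and m
      have T_gt: "T c m = 0" if "m > k" for c m
        using that by (simp add: T_def mult.assoc fps_X_power_mult_nth)
      have T_eq: "T c k = c * fact k" for c
        by (simp add: T_def mult.assoc fps_X_power_mult_nth fps_deriv_funpow_X_power)
      have "(\<Sum>m=0..n. T (s m) m) = (\<Sum>m=0..n. T (t m) m)"
      proof -
        have "(\<Sum>m=0..n. fps_const (s m) * fps_X ^ m * (fps_deriv ^^ m) (fps_X ^ k)) =
          (\<Sum>m=0..n. fps_const (t m) * fps_X ^ m * (fps_deriv ^^ m) (fps_X ^ k))"
          using assms unfolding is_S2_def by metis
        from arg_cong[OF this, of "\<lambda>g. fps_nth g k"] show ?thesis
          by (simp only: fps_sum_nth T_def)
      qed
      moreover have "(\<Sum>m\<in>{0..n} - {k}. T (s m) m) = (\<Sum>m\<in>{0..n} - {k}. T (t m) m)"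
        by (rule sum.cong) (use less T_gt in \<open>auto simp: neq_iff\<close>)
      ultimately have "T (s k) k = T (t k) k"
        using True by (simp add: sum.remove[of "{0..n}" k])
      then show ?thesis by (simp add: T_eq)
    next
      case False
      then show ?thesis using assms by (simp add: is_S2_def)
    qed
  qed
qed

lemma is_S2_S2: "is_S2 d a n (S2 d a n)"
  unfolding S2_def by (rule theI'[of "is_S2 d a n"]) (metis is_S2_exists is_S2_unique)

end

(*
Apply the operator identity to the geometric series G = 1/(1-x). On the left, a + d E_x multiplies
the coefficient of x^m by a + d m, so the result is the generating function of the powers
(a + d m)^n; multiplying by G once more passes to partial sums. On the right, the m-th derivative
of G is m! G^(m+1). Clearing the denominator (1-x)^(n+2) leaves
the sum of S2(n,j) j! x^j (1-x)^(n-j) over j, and the binomial theorem turns this into PrEu.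
*)
theory Submission
  imports Defs
begin

text \<open>The series \<open>1 / (1 - x)\<close>, called \<open>G\<close> below, given by its
  coefficients so that cancellations are plain products rather than divisions.\<close>

definition fps_geometric :: "rat fps" where
  "fps_geometric = Abs_fps (\<lambda>_. 1)"

lemma fps_geometric_mult: "fps_geometric * (1 - fps_X) = 1"
  unfolding fps_geometric_def
  by (rule fps_ext) (simp add: algebra_simps)

lemma fps_geometric_power_mult: "fps_geometric ^ k * (1 - fps_X) ^ k = 1"
  by (simp flip: power_mult_distrib add: fps_geometric_mult)

text \<open>\<open>(1 - x)^k\<close> has constant term 1, hence is a unit, and its inverse is
  unique.\<close>

lemma fps_geometric_power_eq_divide: "1 / (1 - fps_X) ^ k = fps_geometric ^ k"
proof -
  have "fps_geometric ^ k = inverse ((1 - fps_X) ^ k)"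
    by (rule fps_inverse_unique[symmetric]) (simp add: fps_geometric_power_mult mult.commute)
  then show ?thesis
    by (simp add: fps_divide_unit)
qed

lemma fps_deriv_geometric: "fps_deriv fps_geometric = fps_geometric ^ 2"
proof -
  \<comment> \<open>Differentiating \<open>G (1 - x) = 1\<close> gives
    \<open>G' (1 - x) = G\<close>; multiplying by \<open>G\<close> isolates
    \<open>G'\<close>.\<close>
  have "fps_deriv (fps_geometric * (1 - fps_X)) = 0"
    by (simp add: fps_geometric_mult)
  then have "fps_deriv fps_geometric * (1 - fps_X) = fps_geometric"
    by (simp add: algebra_simps)
  then show ?thesis
    by (metis fps_geometric_mult mult.assoc mult.commute mult_1_right power2_eq_square)
qed

lemma fps_deriv_funpow_geometric:
  "(fps_deriv ^^ m) fps_geometric = fps_const (fact m) * fps_geometric ^ Suc m"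
proof (induction m)
  case (Suc m)
  \<comment> \<open>Since \<open>G' = G^2\<close>, differentiating \<open>G^(m+1)\<close> yields
    \<open>(m+1) G^(m+2)\<close>. The product rule for \<open>G * G^m\<close> leaves an exponent
    \<open>m - 1\<close>, hence the split on \<open>m\<close>.\<close>
  then show ?case
    by (simp add: fps_deriv_power' fps_deriv_geometric power2_eq_square fps_of_nat[symmetric]
        fps_const_mult[symmetric] fps_const_add[symmetric] algebra_simps
        del: fps_const_mult fps_const_add) (cases m; simp)
qed simp

lemma fps_nth_aff_op: "fps_nth (aff_op d a f) m = (of_nat a + of_nat d * of_nat m) * fps_nth f m"
  by (cases m) (simp_all add: aff_op_def euler_op_def algebra_simps)

lemma fps_nth_aff_op_funpow:
  "fps_nth ((aff_op d a ^^ n) f) m = (of_nat a + of_nat d * of_nat m) ^ n * fps_nth f m"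
  by (induction n) (simp_all add: fps_nth_aff_op)

lemma partial_sums_eq_mult_geometric:
  "Abs_fps (\<lambda>m. \<Sum>j=0..m. (of_nat a + of_nat d * of_nat j) ^ n) =
    (aff_op d a ^^ n) fps_geometric * fps_geometric"
  by (rule fps_ext) (simp add: fps_mult_nth fps_nth_aff_op_funpow fps_geometric_def)

lemma one_minus_X_power:
  "(1 - fps_X :: rat fps) ^ N = (\<Sum>i=0..N. fps_const ((-1) ^ i * of_nat (N choose i)) * fps_X ^ i)"
proof -
  have "(1 - fps_X :: rat fps) ^ N = (- fps_X + 1) ^ N" by simp
  also have "\<dots> = (\<Sum>i=0..N. of_nat (N choose i) * (- fps_X) ^ i)"
    by (subst binomial_ring) (simp add: atLeast0AtMost)
  also have "\<dots> = (\<Sum>i=0..N. fps_const ((-1) ^ i * of_nat (N choose i)) * fps_X ^ i)"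
  proof (rule sum.cong[OF refl])
    fix i
    have "fps_const ((-1) ^ i :: rat) = (-1) ^ i"
      by (cases "even i") (simp_all add: fps_const_neg[symmetric] del: fps_const_neg)
    then show "of_nat (N choose i) * (- fps_X) ^ i =
        fps_const ((-1) ^ i * of_nat (N choose i) :: rat) * fps_X ^ i"
      by (subst power_minus)
        (simp add: fps_const_mult[symmetric] fps_of_nat mult_ac del: fps_const_mult)
  qed
  finally show ?thesis .
qed

text \<open>Expanding each \<open>(1 - x)^(n-j)\<close> and collecting the coefficient of
  \<open>x^k\<close> produces exactly the alternating sum in \<open>rEu\<close>; the proof runs this
  backwards.\<close>

lemma fps_of_poly_PrEu:
  "fps_of_poly (PrEu d a n) =
    (\<Sum>j=0..n. fps_const (S2 d a n j * fact j) * fps_X ^ j * (1 - fps_X) ^ (n - j))"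
proof -
  define c where
    "c j k = (-1) ^ (k - j) * of_nat ((n - j) choose (k - j)) * S2 d a n j * fact j" for j k
  have "fps_of_poly (PrEu d a n) = (\<Sum>k=0..n. fps_const (rEu d a n k) * fps_X ^ k)"
    by (simp add: PrEu_def fps_of_poly_sum fps_of_poly_monom)
  also have "\<dots> = (\<Sum>k\<le>n. \<Sum>j\<le>k. fps_const (c j k) * fps_X ^ k)"
    by (rule fps_ext)
      (simp add: rEu_def c_def atLeast0AtMost fps_sum_nth sum_distrib_right)
  \<comment> \<open>Both sides sum over the triangle \<open>j \<le> k \<le> n\<close>; swapping the
    pair is the bijection.\<close>
  also have "\<dots> = (\<Sum>j\<le>n. \<Sum>k=j..n. fps_const (c j k) * fps_X ^ k)"
    by (subst sum.Sigma, simp, simp)+ (rule sum.reindex_bij_witness[of _ prod.swap prod.swap]; auto)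
  \<comment> \<open>With \<open>k = i + j\<close>, the index \<open>i\<close> runs through the
    binomial expansion of \<open>(1 - x)^(n-j)\<close>.\<close>
  also have "\<dots> = (\<Sum>j\<le>n. \<Sum>i=0..n - j. fps_const (c j (i + j)) * fps_X ^ (i + j))"
  proof (rule sum.cong[OF refl])
    fix j assume "j \<in> {..n}"
    then show "(\<Sum>k=j..n. fps_const (c j k) * fps_X ^ k) =
        (\<Sum>i=0..n - j. fps_const (c j (i + j)) * fps_X ^ (i + j))"
      using sum.shift_bounds_cl_nat_ivl[of "\<lambda>k. fps_const (c j k) * fps_X ^ k" 0 j "n - j"] by simp
  qed
  also have "\<dots> = (\<Sum>j\<le>n. fps_const (S2 d a n j * fact j) * fps_X ^ j * (1 - fps_X) ^ (n - j))"
    by (simp add: c_def one_minus_X_power sum_distrib_left power_add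
        fps_const_mult[symmetric] mult_ac del: fps_const_mult)
  finally show ?thesis by (simp add: atLeast0AtMost)
qed

theorem mainTheorem13:
  fixes d a n :: nat
  assumes "d \<ge> 1"
  shows "(Abs_fps (\<lambda>m. \<Sum>j=0..m. (of_nat a + of_nat d * of_nat j) ^ n) :: rat fps) =
    1 / (1 - fps_X) ^ (n + 2) * fps_of_poly (PrEu d a n)"
proof -
  have "fps_geometric ^ (n + 2) * fps_of_poly (PrEu d a n) =
      (\<Sum>j=0..n. fps_const (S2 d a n j * fact j) * fps_X ^ j * fps_geometric ^ (j + 2))"
    unfolding fps_of_poly_PrEu sum_distrib_left
  proof (rule sum.cong[OF refl])
    fix j assume "j \<in> {0..n}"
    \<comment> \<open>As \<open>j \<le> n\<close>, the exponent splits as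
      \<open>n + 2 = (j + 2) + (n - j)\<close>, and the second factor cancels
      \<open>(1 - x)^(n-j)\<close>.\<close>
    then have "fps_geometric ^ (n + 2) = fps_geometric ^ (j + 2) * fps_geometric ^ (n - j)"
      by (simp flip: power_add)
    moreover have "fps_geometric ^ (n - j) * (1 - fps_X) ^ (n - j) = 1"
      by (rule fps_geometric_power_mult)
    ultimately have "fps_geometric ^ (n + 2) * (1 - fps_X) ^ (n - j) = fps_geometric ^ (j + 2)"
      by (simp only: mult.assoc mult_1_right)
    from arg_cong[OF this, of "\<lambda>g. fps_const (S2 d a n j * fact j) * fps_X ^ j * g"]
    show "fps_geometric ^ (n + 2) *
          (fps_const (S2 d a n j * fact j) * fps_X ^ j * (1 - fps_X) ^ (n - j)) =
        fps_const (S2 d a n j * fact j) * fps_X ^ j * fps_geometric ^ (j + 2)"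
      by (simp only: mult.assoc mult.left_commute)
  qed
  \<comment> \<open>Of \<open>G^(j+2)\<close>, the part \<open>j! G^(j+1)\<close> is the
    \<open>j\<close>-th derivative of \<open>G\<close>; the spare \<open>G\<close> will form the
    partial sums.\<close>
  also have "\<dots> = (\<Sum>j=0..n. fps_const (S2 d a n j) * fps_X ^ j *
      (fps_deriv ^^ j) fps_geometric) * fps_geometric"
    by (simp add: sum_distrib_left sum_distrib_right fps_deriv_funpow_geometric fps_const_mult[symmetric] mult_ac
        del: fps_const_mult)
  also have "\<dots> = (aff_op d a ^^ n) fps_geometric * fps_geometric"
    using is_S2_S2[of d a n] by (simp add: is_S2_def)
  finally show ?thesis
    by (simp only: fps_geometric_power_eq_divide partial_sums_eq_mult_geometric)
qed

end
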